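(* Let $u,v,t$ be integers with $(u-1)(v-2)=2t^3$. Then $(u,v,P,\mathbb{Q})$ is true if and only if $t=0$ or $t=1$.
   Context: For integers $u,v$, the phrase "$(u,v,P,\mathbb{Q})$ is true" means: there exist $a,b\in\mathbb{Q}$ with $a\neq 0$ such that the polynomial $P(x,y)=axy+bx+by+\frac{b^2-b}{a}\in\mathbb{Q}[x,y]$, which defines a commutative group operation $x\oplus y=P(x,y)$ on the set $\mathbb{Q}\setminus\{-b/a\}$, satisfies $1\oplus 1=u$ and $2\oplus 2=v$, i.e. $P(1,1)=u$ and $P(2,2)=v$. (The conditions are on the values of the polynomial; it is not required that $1$ and $2$ differ from $-b/a$.) *)

theory Defs
  imports Complex_Main "HOL-Algebra.Group"
begin

text \<open>
  The polynomial \<open>P\<close> is represented by its evaluation function on rational arguments.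
  For \<open>a \<noteq> 0\<close> it is conjugate to multiplication via
  \<open>a * P(x,y) + b = (a * x + b) * (a * y + b)\<close>.
\<close>

definition opoly :: "rat \<Rightarrow> rat \<Rightarrow> rat \<Rightarrow> rat \<Rightarrow> rat" where
  "opoly a b x y = a * x * y + b * x + b * y + (b\<^sup>2 - b) / a"

definition ogroup :: "rat \<Rightarrow> rat \<Rightarrow> rat monoid" where
  "ogroup a b = \<lparr>carrier = UNIV - {- b / a}, mult = opoly a b, one = (1 - b) / a\<rparr>"

lemma opoly_conjugate:
  assumes "a \<noteq> 0"
  shows "a * opoly a b x y + b = (a * x + b) * (a * y + b)"
proof -
  have "a * ((b\<^sup>2 - b) / a) = b\<^sup>2 - b"
    using assms by simp
  then show ?thesis
    unfolding opoly_def distrib_left by (simp add: power2_eq_square algebra_simps)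
qed

text \<open>
  The group property holds for all \<open>a \<noteq> 0\<close> and all \<open>b\<close>, so it need not be
  repeated as a condition in the definition of \<open>uvPQ_true\<close> below.
\<close>

lemma comm_group_ogroup:
  assumes a: "a \<noteq> 0"
  shows "comm_group (ogroup a b)"
proof -
  have car: "x \<in> carrier (ogroup a b) \<longleftrightarrow> a * x + b \<noteq> 0" for x
  proof -
    have "x = - b / a \<longleftrightarrow> a * x + b = 0"
      by (metis a nonzero_eq_divide_eq eq_neg_iff_add_eq_0 mult.commute)
    then show ?thesis by (simp only: ogroup_def partial_object.simps, blast)
  qed
  have mul: "a * (x \<otimes>\<^bsub>ogroup a b\<^esub> y) + b = (a * x + b) * (a * y + b)" for x y
    using opoly_conjugate[OF a] by (simp add: ogroup_def)
  have one: "a * \<one>\<^bsub>ogroup a b\<^esub> + b = 1"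
    using a by (simp add: ogroup_def)
  have eqI: "x = y" if "a * x + b = a * y + b" for x y :: rat
    using that a by simp
  show ?thesis
  proof (rule comm_groupI)
    fix x assume x: "x \<in> carrier (ogroup a b)"
    let ?y = "(1 / (a * x + b) - b) / a"
    have y: "a * ?y + b = 1 / (a * x + b)" using a by simp
    show "\<exists>y\<in>carrier (ogroup a b). y \<otimes>\<^bsub>ogroup a b\<^esub> x = \<one>\<^bsub>ogroup a b\<^esub>"
    proof (rule bexI)
      show "?y \<otimes>\<^bsub>ogroup a b\<^esub> x = \<one>\<^bsub>ogroup a b\<^esub>"
      proof (rule eqI)
        show "a * (?y \<otimes>\<^bsub>ogroup a b\<^esub> x) + b = a * \<one>\<^bsub>ogroup a b\<^esub> + b"
          using x unfolding mul one y car by simp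
      qed
      show "?y \<in> carrier (ogroup a b)"
        using x unfolding car y by simp
    qed
  next
    fix x y assume "x \<in> carrier (ogroup a b)" "y \<in> carrier (ogroup a b)"
    then show "x \<otimes>\<^bsub>ogroup a b\<^esub> y \<in> carrier (ogroup a b)"
      by (simp only: car mul, simp)
  next
    show "\<one>\<^bsub>ogroup a b\<^esub> \<in> carrier (ogroup a b)"
      unfolding car one by simp
  next
    fix x y z
    show "x \<otimes>\<^bsub>ogroup a b\<^esub> y \<otimes>\<^bsub>ogroup a b\<^esub> z = x \<otimes>\<^bsub>ogroup a b\<^esub> (y \<otimes>\<^bsub>ogroup a b\<^esub> z)"
      by (rule eqI) (simp only: mul mult.assoc)
  next
    fix x y
    show "x \<otimes>\<^bsub>ogroup a b\<^esub> y = y \<otimes>\<^bsub>ogroup a b\<^esub> x"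
      by (rule eqI) (simp only: mul mult.commute)
  next
    fix x
    show "\<one>\<^bsub>ogroup a b\<^esub> \<otimes>\<^bsub>ogroup a b\<^esub> x = x"
      by (rule eqI) (simp only: mul one mult_1)
  qed
qed

text \<open>
  The conditions \<open>1 \<oplus> 1 = u\<close> and \<open>2 \<oplus> 2 = v\<close> concern the values of the polynomial only:
  \<open>1\<close> and \<open>2\<close> are allowed to equal the excluded point \<open>- b / a\<close>.
\<close>

definition uvPQ_true :: "int \<Rightarrow> int \<Rightarrow> bool" where
  "uvPQ_true u v \<longleftrightarrow>
     (\<exists>a b :: rat. a \<noteq> 0 \<and> opoly a b 1 1 = of_int u \<and> opoly a b 2 2 = of_int v)"

end

theory Submission
  imports Defs "HOL-Computational_Algebra.Nth_Powers"
begin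

text \<open>
  Put \<open>k = u - 1\<close> and \<open>l = v - 2\<close>. Since \<open>a * P(x,y) + b = (a x + b) (a y + b)\<close>, the two
  conditions say that \<open>s = a + b\<close> and \<open>s + a\<close> satisfy \<open>s\<^sup>2 - s = a k\<close> and
  \<open>(s + a)\<^sup>2 - (s + a) = a l\<close>. Subtracting and cancelling \<open>a\<close> makes \<open>s\<close> an affine function of
  \<open>a\<close>; what remains is the quadratic equation \<open>(k + l - a)\<^sup>2 = 1 + 4 k l\<close> for \<open>a\<close>. Hence the
  statement for \<open>u, v\<close> means exactly that \<open>1 + 4 k l\<close> is a square
  (\<open>uvPQ_true_iff_square\<close>). For \<open>k l = 2 t\<^sup>3\<close> this number is \<open>(2 t)\<^sup>3 + 1\<close>, so the theorem asks for
  the integral points with even abscissa on the elliptic curve \<open>y\<^sup>2 = x\<^sup>3 + 1\<close>.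

  They are found by Euler's descent. Write \<open>F b c = c\<^sup>2 - 3 b c + 3 b\<^sup>2\<close>; with \<open>c = x + 1\<close> one has
  \<open>x\<^sup>3 + 1 = c * F 1 c\<close>, and the descent treats the homogeneous condition that \<open>b c F(b,c)\<close> is a
  square, for coprime positive \<open>b, c\<close> with \<open>c\<close> prime to 3. The three factors are then
  pairwise coprime, hence squares. Parametrizing first the conic \<open>F(b,c) = f\<^sup>2\<close>
  (\<open>parametrize_F_square\<close>) and then the conic \<open>m\<^sup>2 - 3 n\<^sup>2 = \<gamma>\<^sup>2\<close> obtained from \<open>c = \<gamma>\<^sup>2\<close>
  (\<open>parametrize_norm_square\<close>) turns the fact that \<open>b\<close> is a square into the same condition for a pair
  \<open>(q, p)\<close> with \<open>q \<le> b\<close>. Only \<open>b = c = 1\<close> survives (\<open>descent\<close>). On the curve, \<open>c = 1\<close> is the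
  point with \<open>t = 0\<close>; when 3 divides \<open>c = 3 d\<close>, the identity \<open>F(1, 3 d) = 3 F(d, 1)\<close>
  moves the problem to the pair \<open>(d, 1)\<close>, and \<open>d = 1\<close> is the point with \<open>t = 1\<close>.
\<close>

section \<open>Squares and lowest terms\<close>

lemma square_mod_3:
  fixes x :: int
  assumes "\<not> 3 dvd x"
  shows "x\<^sup>2 mod 3 = 1"
proof -
  have "x mod 3 = 1 \<or> x mod 3 = 2"
    using assms by presburger
  moreover have "x\<^sup>2 mod 3 = (x mod 3)\<^sup>2 mod 3"
    by (simp add: power_mod)
  ultimately show ?thesis by auto
qed

lemma int_square_is_square_nat:
  fixes x y :: int
  assumes "x \<ge> 0" "x = y\<^sup>2"
  shows "is_square (nat x)"
  using assms by (metis is_nth_power_nth_power nat_abs_int_diff nat_power_eq abs_ge_zero power2_abs)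

lemma coprime_factor_of_square:
  fixes x y z :: int
  assumes "coprime x y" "x > 0" "y > 0" "x * y = z\<^sup>2"
  obtains w where "x = w\<^sup>2"
proof -
  have "is_square (nat x * nat y)"
    using int_square_is_square_nat[of "x * y" z] assms(2,3)
    by (simp add: assms(4) nat_mult_distrib[symmetric])
  moreover have "coprime (nat x) (nat y)"
    using assms by (metis coprime_int_iff int_nat_eq less_imp_le)
  ultimately have "is_square (nat x)"
    using assms by (intro is_nth_power_mult_coprime_natD(1)[of "nat x" "nat y"]) auto
  then obtain k where "nat x = k\<^sup>2" by (auto elim: is_nth_powerE)
  then have "x = (int k)\<^sup>2" using assms by (metis int_nat_eq less_imp_le of_nat_power)
  then show ?thesis by (rule that)
qed

lemma lowest_terms:
  fixes x y :: int
  assumes "y > 0"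
  obtains g p q where "x = g * p" "y = g * q" "coprime p q" "g > 0" "q > 0"
proof -
  have g: "gcd x y > 0" using assms by simp
  then obtain p q where "x = p * gcd x y" "y = q * gcd x y" "coprime p q"
    using gcd_coprime_exists[of x y] by auto
  then show ?thesis
    using that[of "gcd x y" p q] g assms by (metis mult.commute zero_less_mult_pos)
qed

lemma square_of_scaled_square:
  fixes h x y :: int
  assumes "h \<noteq> 0" "h\<^sup>2 * x = y\<^sup>2"
  obtains z where "x = z\<^sup>2"
proof -
  have "h\<^sup>2 dvd y\<^sup>2" using assms by (metis dvd_triv_left)
  then obtain z where "y = h * z" by (auto elim: dvdE)
  then show ?thesis using assms that[of z] by (simp add: power_mult_distrib)
qed

lemma rational_root_of_integer:
  fixes s :: rat and N :: int
  assumes "s\<^sup>2 = of_int N"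
  obtains r where "N = r\<^sup>2"
proof -
  obtain p q where s: "s = of_int p / of_int q" and q: "q > 0"
    by (metis quotient_of_div quotient_of_denom_pos prod.collapse)
  have "(of_int p :: rat)\<^sup>2 = of_int (q\<^sup>2 * N)"
    using assms q by (simp add: s field_simps)
  then have "q\<^sup>2 * N = p\<^sup>2"
    by (metis of_int_eq_iff of_int_power)
  then show ?thesis using q square_of_scaled_square[of q N p] that by auto
qed

section \<open>Euler's descent on \<open>b c F(b,c) = r\<^sup>2\<close>\<close>

text \<open>
  The homogeneous cofactor in \<open>x\<^sup>3 + b\<^sup>3 = (x + b) (x\<^sup>2 - x b + b\<^sup>2)\<close>, written in terms of
  \<open>c = x + b\<close>.
\<close>

definition F :: "int \<Rightarrow> int \<Rightarrow> int" where
  "F b c = c\<^sup>2 - 3 * b * c + 3 * b\<^sup>2"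

lemma F_pos:
  assumes "b > 0"
  shows "F b c > 0"
proof -
  have "4 * F b c = (2 * c - 3 * b)\<^sup>2 + 3 * b\<^sup>2"
    by (simp add: F_def power2_eq_square algebra_simps)
  moreover have "b\<^sup>2 > 0" using assms by simp
  ultimately show ?thesis using zero_le_power2[of "2 * c - 3 * b"] by linarith
qed

lemma coprime_F:
  assumes "coprime b c" "\<not> 3 dvd c"
  shows "coprime b (F b c)" "coprime c (F b c)"
proof -
  have "coprime 3 c"
    using assms(2) by (simp add: prime_imp_coprime)
  then have "coprime c (3 * b\<^sup>2)"
    using assms(1) by (simp add: coprime_commute)
  moreover have "F b c = (c - 3 * b) * c + 3 * b\<^sup>2"
    by (simp add: F_def power2_eq_square algebra_simps)
  ultimately show "coprime c (F b c)"
    by (simp only: coprime_iff_gcd_eq_1 gcd_add_mult)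
  have "F b c = (3 * b - 3 * c) * b + c\<^sup>2"
    by (simp add: F_def power2_eq_square algebra_simps)
  moreover have "coprime b (c\<^sup>2)" using assms(1) by simp
  ultimately show "coprime b (F b c)"
    by (simp only: coprime_iff_gcd_eq_1 gcd_add_mult)
qed

text \<open>
  The conic \<open>c\<^sup>2 - 3 b c + 3 b\<^sup>2 = e\<^sup>2\<close> is cut by lines \<open>e = (m / n) b - c\<close> through its rational
  point \<open>b = 0\<close>, \<open>e = - c\<close>, which gives the ratio
  \<open>b : c = n (2 m - 3 n) : (m\<^sup>2 - 3 n\<^sup>2)\<close>. Since
  \<open>3 n\<^sup>2 = (2 m - 3 n) (2 m + 3 n) - 4 (m\<^sup>2 - 3 n\<^sup>2)\<close>, the two sides of this ratio can only have a
  common factor 3; choosing the sign of \<open>e\<close> such that \<open>m\<close> is prime to 3 excludes it. The remaining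
  sign is fixed modulo 3, because \<open>c\<close> and \<open>m\<^sup>2\<close> are both 1 there.
\<close>

lemma parametrize_F_square:
  fixes b c f \<gamma> :: int
  assumes b: "b > 0" and cop: "coprime b c" and c3: "\<not> 3 dvd c" 
    and c: "c = \<gamma>\<^sup>2" and F: "F b c = f\<^sup>2"
  obtains m n where "coprime m n" "n > 0" "\<not> 3 dvd m" "b = n * (2 * m - 3 * n)" "c = m\<^sup>2 - 3 * n\<^sup>2"
proof -
  \<comment> \<open>\<open>c + f\<close> and \<open>c - f\<close> add up to \<open>2 c\<close>, so 3 does not divide both\<close>
  obtain e where e: "F b c = e\<^sup>2" "\<not> 3 dvd c + e"
  proof (cases "3 dvd c + f")
    case True
    then have "\<not> 3 dvd c + (- f)" using c3 by presburger
    then show ?thesis using F that[of "- f"] by simp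
  qed (use F that in blast)
  obtain g m n where gm: "c + e = g * m" and gn: "b = g * n"
    and mn: "coprime m n" and g: "g > 0" and n: "n > 0"
    using lowest_terms[OF b] .
  have m3: "\<not> 3 dvd m" using e(2) gm by auto
  \<comment> \<open>eliminate \<open>e\<close>: the terms \<open>c\<^sup>2\<close> cancel, leaving the factor \<open>g\<close>\<close>
  have "g * (g * (m\<^sup>2 - 3 * n\<^sup>2)) = g * (c * (2 * m - 3 * n))"
  proof -
    have "e = g * m - c" using gm by simp
    then have "c\<^sup>2 - 3 * (g * n) * c + 3 * (g * n)\<^sup>2 = (g * m - c)\<^sup>2"
      using e(1) unfolding F_def gn by simp
    then show ?thesis by (simp add: power2_eq_square algebra_simps)
  qed
  then have key: "g * (m\<^sup>2 - 3 * n\<^sup>2) = c * (2 * m - 3 * n)" using g by simp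
  have "coprime g c" using cop gn by simp
  then have "g dvd 2 * m - 3 * n"
    using key by (metis coprime_dvd_mult_right_iff dvd_triv_left)
  then obtain h where h: "2 * m - 3 * n = g * h" ..
  then have ch: "m\<^sup>2 - 3 * n\<^sup>2 = c * h" using key g by simp
  have m2: "m\<^sup>2 mod 3 = 1" using square_mod_3[OF m3] .
  have "\<not> 3 dvd \<gamma>" using c3 c by (auto simp: power2_eq_square)
  then have c2: "c mod 3 = 1" unfolding c by (rule square_mod_3)
  have "h dvd 3"
  proof -
    have "3 * n\<^sup>2 = (2 * m - 3 * n) * (2 * m + 3 * n) - 4 * (m\<^sup>2 - 3 * n\<^sup>2)"
      by (simp add: power2_eq_square algebra_simps)
    also have "\<dots> = h * (g * (2 * m + 3 * n) - 4 * c)"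
      unfolding h ch by (simp add: algebra_simps)
    finally have "h dvd 3 * n\<^sup>2" by simp
    moreover have "coprime h (n\<^sup>2)"
    proof -
      have "coprime (n\<^sup>2) (m\<^sup>2)" using mn by (simp add: coprime_commute)
      moreover have "m\<^sup>2 = c * h + 3 * n\<^sup>2" using ch by simp
      ultimately show ?thesis
        by (metis coprime_common_divisor coprimeI dvd_add dvd_mult)
    qed
    ultimately show ?thesis by (simp add: coprime_dvd_mult_left_iff)
  qed
  moreover have "\<not> 3 dvd h"
  proof
    assume "3 dvd h"
    then have "3 dvd m\<^sup>2 - 3 * n\<^sup>2" using ch by simp
    then show False using m2 by presburger
  qed
  moreover have "h \<noteq> -1"
  proof
    assume "h = -1"
    then have "m\<^sup>2 - 3 * n\<^sup>2 = - c" using ch by simp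
    then show False using m2 c2 by presburger
  qed
  ultimately have "h = 1"
  proof -
    assume a: "h dvd 3" "\<not> 3 dvd h" "h \<noteq> -1"
    have "\<bar>h\<bar> \<le> 3" using dvd_imp_le_int[OF _ a(1)] by simp
    then have "h \<in> {-3, -2, -1, 0, 1, 2, 3}" by auto
    then show ?thesis using a by auto
  qed
  then show ?thesis using that[of m n] mn n m3 h ch gn by simp
qed

text \<open>
  Lines \<open>d = m - (p / q) n\<close> through the point \<open>n = 0\<close>, \<open>d = m\<close> of the conic
  \<open>m\<^sup>2 - 3 n\<^sup>2 = d\<^sup>2\<close> give \<open>2 m : n = (p\<^sup>2 + 3 q\<^sup>2) : p q\<close>. The right-hand side is in lowest terms
  as soon as \<open>p\<close> is prime to 3, which is again arranged by the sign of \<open>d\<close>. The factor \<open>h\<close>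
  (in fact 1 or 2) is kept because \<open>2 m\<close> and \<open>n\<close> may both be even.
\<close>

lemma parametrize_norm_square:
  fixes m n \<gamma> :: int
  assumes mn: "coprime m n" and n: "n > 0" and m: "m > 0" and m3: "\<not> 3 dvd m"
    and \<gamma>: "m\<^sup>2 - 3 * n\<^sup>2 = \<gamma>\<^sup>2"
  obtains p q h where "coprime q p" "p > 0" "q > 0" "\<not> 3 dvd p" "h > 0"
    "2 * m = h * (p\<^sup>2 + 3 * q\<^sup>2)" "n = h * p * q"
proof -
  obtain d where d: "m\<^sup>2 - 3 * n\<^sup>2 = d\<^sup>2" "\<not> 3 dvd m - d"
  proof (cases "3 dvd m - \<gamma>")
    case True
    then have "\<not> 3 dvd m - (- \<gamma>)" using m3 by presburger
    then show ?thesis using \<gamma> that[of "- \<gamma>"] by simp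
  qed (use \<gamma> that in blast)
  obtain g p q where gp: "m - d = g * p" and gq: "n = g * q"
    and pq: "coprime p q" and g: "g > 0" and q: "q > 0"
    using lowest_terms[OF n] .
  have p3: "\<not> 3 dvd p" using d(2) gp by auto
  have "g * (2 * m * p) = g * (g * (p\<^sup>2 + 3 * q\<^sup>2))"
  proof -
    have "d = m - g * p" using gp by simp
    then have "m\<^sup>2 - 3 * (g * q)\<^sup>2 = (m - g * p)\<^sup>2"
      using d(1) unfolding gq by simp
    then show ?thesis by (simp add: power2_eq_square algebra_simps)
  qed
  then have key: "2 * m * p = g * (p\<^sup>2 + 3 * q\<^sup>2)" using g by simp
  have "p\<^sup>2 + 3 * q\<^sup>2 > 0" using q by (simp add: add_nonneg_pos)
  then have "2 * m * p > 0" using key g by simp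
  then have p: "p > 0" using m by (simp add: zero_less_mult_iff)
  have "p dvd g"
  proof -
    have "p * (2 * m - g * p) = g * (3 * q\<^sup>2)"
      using key by (simp add: power2_eq_square algebra_simps)
    then have "p dvd g * (3 * q\<^sup>2)" by (metis dvd_triv_left)
    moreover have "coprime 3 p" using p3 by (simp add: prime_imp_coprime)
    then have "coprime p (3 * q\<^sup>2)" using pq by (simp add: coprime_commute)
    ultimately show ?thesis by (simp add: coprime_dvd_mult_left_iff)
  qed
  then obtain h where h: "g = p * h" ..
  show ?thesis
  proof (rule that[of q p h])
    have "p * (2 * m) = p * (h * (p\<^sup>2 + 3 * q\<^sup>2))" using key h by (simp add: algebra_simps)
    then show "2 * m = h * (p\<^sup>2 + 3 * q\<^sup>2)" using p by (metis mult_left_cancel less_irrefl)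
    show "n = h * p * q" using gq h by simp
    show "h > 0" using g h p by (simp add: zero_less_mult_iff)
  qed (use pq p q p3 in \<open>auto simp: coprime_commute\<close>)
qed

text \<open>
  Substituting the second parametrization into \<open>b = n (2 m - 3 n)\<close> gives
  \<open>b = h\<^sup>2 * (q * p * F q p)\<close>, the identity that closes the descent: as \<open>b\<close> is a square, so is
  \<open>q * p * F q p\<close>, and \<open>q\<close> divides \<open>b\<close>. If \<open>q < b\<close>, induction gives \<open>p = q = 1\<close>; if \<open>q = b\<close>, the
  cofactors \<open>p\<close> and \<open>F q p\<close> are 1, and again \<open>p = q = 1\<close>. Going back up,
  \<open>p = q = 1\<close> yields only \<open>b = c = 1\<close>.
\<close>

lemma descent:
  fixes b c r :: int
  assumes "b > 0" "c > 0" "coprime b c" "\<not> 3 dvd c" "b * c * F b c = r\<^sup>2"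
  shows "b = 1 \<and> c = 1"
  using assms
proof (induction "nat b" arbitrary: b c r rule: less_induct)
  case (less b c r)
  note b = less.prems(1) and c = less.prems(2) and cop = less.prems(3)
    and c3 = less.prems(4) and sq = less.prems(5)
  note copF = coprime_F[OF cop c3] and Fpos = F_pos[OF b, of c]
  obtain \<beta> where \<beta>: "b = \<beta>\<^sup>2"
    using coprime_factor_of_square[of b "c * F b c" r] cop copF b c Fpos sq
    by (auto simp: mult.assoc)
  obtain \<gamma> where \<gamma>: "c = \<gamma>\<^sup>2"
    using coprime_factor_of_square[of c "b * F b c" r] cop copF b c Fpos sq
    by (auto simp: coprime_commute mult_ac)
  obtain f where f: "F b c = f\<^sup>2"
    using coprime_factor_of_square[of "F b c" "b * c" r] cop copF b c Fpos sq
    by (auto simp: coprime_commute mult_ac)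
  obtain m n where mn: "coprime m n" and n: "n > 0" and m3: "\<not> 3 dvd m"
    and bmn: "b = n * (2 * m - 3 * n)" and cmn: "c = m\<^sup>2 - 3 * n\<^sup>2"
    using parametrize_F_square[OF b cop c3 \<gamma> f] .
  have "2 * m - 3 * n > 0" using b bmn n by (simp add: zero_less_mult_iff)
  then have m: "m > 0" using n by linarith
  obtain p q h where qp: "coprime q p" and p: "p > 0" and q: "q > 0" and p3: "\<not> 3 dvd p"
    and h: "h > 0" and mpq: "2 * m = h * (p\<^sup>2 + 3 * q\<^sup>2)" and npq: "n = h * p * q"
    using parametrize_norm_square[OF mn n m m3] cmn \<gamma> by metis
  have bpq: "b = h\<^sup>2 * (q * p * F q p)"
    unfolding bmn mpq npq F_def by (simp add: power2_eq_square algebra_simps)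
  then obtain s where s: "q * p * F q p = s\<^sup>2"
    using square_of_scaled_square[of h _ \<beta>] h \<beta> by auto
  have Fq: "F q p \<ge> 1" using F_pos[OF q, of p] by simp
  have "q = 1 \<and> p = 1"
  proof (cases "q < b")
    case True
    then show ?thesis using less.hyps[of q p s] q p qp p3 s b by simp
  next
    case False
    have "h\<^sup>2 * (p * F q p) \<ge> 1" using h p Fq by (smt (verit) mult_pos_pos zero_less_power)
    moreover have "b = q * (h\<^sup>2 * (p * F q p))" using bpq by (simp add: algebra_simps)
    ultimately have "h\<^sup>2 * (p * F q p) = 1"
      using False q by (smt (verit) mult_less_cancel_left1 mult_le_cancel_left1)
    then have "p * (h\<^sup>2 * F q p) = 1" "F q p * (h\<^sup>2 * p) = 1" by (simp_all add: algebra_simps)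
    then have "p = 1" "F q p = 1"
      using p Fq by (metis pos_zmult_eq_1_iff less_le_trans zero_less_one)+
    then have "q * (q - 1) = 0" by (simp add: F_def power2_eq_square algebra_simps)
    then show ?thesis using q \<open>p = 1\<close> by simp
  qed
  then have "m = 2 * h" "n = h" using mpq npq by auto
  moreover from this have "h = 1" using mn h by (simp add: coprime_iff_gcd_eq_1)
  ultimately show ?case using bmn cmn by simp
qed

text \<open>
  For \<open>c = 2 t + 1\<close> the left-hand side is \<open>c * F 1 c\<close>. If \<open>c = 3 d\<close>, the pair \<open>(1, c)\<close> is outside
  the scope of the descent, but \<open>c * F 1 c = 9 * d * F d 1\<close> replaces it by \<open>(d, 1)\<close>.
\<close>

lemma eight_cubes_plus_one_square:
  fixes t r :: int
  assumes "8 * t ^ 3 + 1 = r\<^sup>2"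
  shows "t = 0 \<or> t = 1"
proof -
  have "t \<ge> 0"
  proof (rule ccontr)
    assume "\<not> t \<ge> 0"
    then have "t ^ 3 < 0" by simp
    then show False using assms zero_le_power2[of r] by linarith
  qed
  have eq: "(2 * t + 1) * F 1 (2 * t + 1) = r\<^sup>2"
    unfolding assms[symmetric] F_def by (simp add: power2_eq_square power3_eq_cube algebra_simps)
  show ?thesis
  proof (cases "3 dvd 2 * t + 1")
    case False
    then show ?thesis using descent[of 1 "2 * t + 1" r] eq \<open>t \<ge> 0\<close> by simp
  next
    case True
    then obtain d where d: "2 * t + 1 = 3 * d" ..
    then have "d > 0" using \<open>t \<ge> 0\<close> by linarith
    have "3\<^sup>2 * (d * 1 * F d 1) = r\<^sup>2"
      using eq unfolding d F_def by (simp add: power2_eq_square algebra_simps)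
    then obtain s where "d * 1 * F d 1 = s\<^sup>2"
      using square_of_scaled_square[of 3] by (metis zero_neq_numeral)
    then have "d = 1" using descent[of d 1 s] \<open>d > 0\<close> by simp
    then show ?thesis using d by simp
  qed
qed

section \<open>Reduction to a square discriminant\<close>

text \<open>
  The roots \<open>a = m + n - r\<close> and \<open>a = m + n + r\<close> of the quadratic for \<open>a\<close> (with \<open>m = u - 1\<close> and
  \<open>n = v - 2\<close>) cannot both violate \<open>a \<noteq> 0\<close>: they differ by \<open>2 r\<close>, and \<open>r\<close> is odd. A rational
  square root of an integer is an integer, so \<open>r\<close> can be taken integral.
\<close>

lemma uvPQ_true_iff_square:
  "uvPQ_true u v \<longleftrightarrow> (\<exists>r. 1 + 4 * ((u - 1) * (v - 2)) = r\<^sup>2)"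
proof
  assume "uvPQ_true u v"
  then obtain a b :: rat where a: "a \<noteq> 0" and P: "opoly a b 1 1 = of_int u" "opoly a b 2 2 = of_int v"
    unfolding uvPQ_true_def by blast
  define m n :: rat where "m = of_int (u - 1)" and "n = of_int (v - 2)"
  have "(a + b)\<^sup>2 - (a + b) = a * m" "(2 * a + b)\<^sup>2 - (2 * a + b) = a * n"
    using opoly_conjugate[OF a, of b 1 1] opoly_conjugate[OF a, of b 2 2] P
    by (simp_all add: m_def n_def power2_eq_square algebra_simps)
  note e = this
  have "a * (2 * (a + b) + a - 1) = a * (n - m)"
    using e by (simp add: power2_eq_square algebra_simps)
  then have "2 * (a + b) + a - 1 = n - m" using a mult_left_cancel by blast
  then have b: "2 * b = n - m - 3 * a + 1" by (simp add: algebra_simps)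
  \<comment> \<open>\<open>n + m - a\<close> is the square root of the discriminant, read off from the quadratic formula\<close>
  have "(n + m - a)\<^sup>2 - (1 + 4 * (m * n)) = 4 * ((a + b)\<^sup>2 - (a + b) - a * m)"
  proof -
    have "4 * ((a + b)\<^sup>2 - (a + b) - a * m) = (2 * a + 2 * b)\<^sup>2 - 2 * (2 * a + 2 * b) - 4 * a * m"
      by (simp add: power2_eq_square algebra_simps)
    then show ?thesis unfolding b by (simp add: power2_eq_square algebra_simps)
  qed
  then have "(n + m - a)\<^sup>2 = of_int (1 + 4 * ((u - 1) * (v - 2)))"
    using e(1) by (simp add: m_def n_def)
  then show "\<exists>r. 1 + 4 * ((u - 1) * (v - 2)) = r\<^sup>2"
    using rational_root_of_integer by metis
next
  assume "\<exists>r. 1 + 4 * ((u - 1) * (v - 2)) = r\<^sup>2"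
  then obtain r0 where r0: "1 + 4 * ((u - 1) * (v - 2)) = r0\<^sup>2" ..
  define m n where "m = u - 1" and "n = v - 2"
  have "r0 \<noteq> 0"
  proof
    assume "r0 = 0"
    then have "4 * ((u - 1) * (v - 2)) = - 1" using r0 by simp
    then have "4 dvd (- 1 :: int)" by (metis dvd_triv_left)
    then show False by simp
  qed
  obtain r where r: "1 + 4 * (m * n) = r\<^sup>2" and ne: "m + n \<noteq> r"
  proof (cases "m + n = r0")
    case True
    then have "m + n \<noteq> - r0" using \<open>r0 \<noteq> 0\<close> by simp
    then show ?thesis using r0 that[of "- r0"] by (simp add: m_def n_def)
  qed (use r0 that in \<open>simp add: m_def n_def\<close>)
  define M N R :: rat where "M = of_int m" and "N = of_int n" and "R = of_int r"
  define a b where "a = M + N - R" and "b = (N - M - 3 * a + 1) / 2"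
  have a: "a \<noteq> 0" using ne unfolding a_def M_def N_def R_def
    by (metis eq_iff_diff_eq_0 of_int_add of_int_eq_iff)
  have R: "1 + 4 * (M * N) = R\<^sup>2"
    using arg_cong[OF r, of "of_int :: int \<Rightarrow> rat"] by (simp add: M_def N_def R_def)
  have "a * opoly a b 1 1 = a * (M + 1)" "a * opoly a b 2 2 = a * (N + 2)"
  proof -
    have R': "R * R = 1 + 4 * (M * N)" using R by (simp add: power2_eq_square)
    have "(a + b) * (a + b) - b = a * (M + 1)" "(2 * a + b) * (2 * a + b) - b = a * (N + 2)"
      unfolding b_def a_def using R' by (simp_all add: field_simps)
    then show "a * opoly a b 1 1 = a * (M + 1)" "a * opoly a b 2 2 = a * (N + 2)"
      using opoly_conjugate[OF a, of b 1 1] opoly_conjugate[OF a, of b 2 2] 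
      by (simp_all add: algebra_simps)
  qed
  then have "opoly a b 1 1 = of_int u" "opoly a b 2 2 = of_int v"
    using a by (simp_all add: M_def N_def m_def n_def)
  then show "uvPQ_true u v" unfolding uvPQ_true_def using a by blast
qed

theorem theorem4:
  fixes u v t :: int
  assumes "(u - 1) * (v - 2) = 2 * t ^ 3"
  shows "uvPQ_true u v \<longleftrightarrow> t = 0 \<or> t = 1"
proof -
  have "uvPQ_true u v \<longleftrightarrow> (\<exists>r. 8 * t ^ 3 + 1 = r\<^sup>2)"
    unfolding uvPQ_true_iff_square assms by (simp add: add.commute)
  moreover have "8 * t ^ 3 + 1 = (1 + 2 * t)\<^sup>2" if "t = 0 \<or> t = 1"
    using that by auto
  ultimately show ?thesis using eight_cubes_plus_one_square by blast
qed

end
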